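(* Let $(\Omega,\mathcal F,\mathbb P)$ be a probability space, $(\mathcal F_t)_{t\ge0}$ a filtration, and let $(X_t)_{t\ge1}$ be a process adapted to $(\mathcal F_t)$ with $0\le X_t\le1$ a.s. for all $t\ge1$. Let $\mathcal R\subseteq\mathcal F$ be a $\sigma$-algebra and define $\mathcal H_t:=\mathcal R\vee\mathcal F_t$ for $t\ge0$ and $m_t:=\mathbb E[X_t\mid\mathcal H_{t-1}]$ for $t\ge1$. If there exists a random variable $\theta$ such that $$\frac1n\sum_{t=1}^nm_t\longrightarrow\theta\quad\text{a.s.},$$ then the empirical mean stabilizes to the same limit: $$\bar X_n:=\frac1n\sum_{t=1}^nX_t\longrightarrow\theta\quad\text{a.s.}$$ Equivalently, $\bar X_n-\frac1n\sum_{t=1}^nm_t\to0$ a.s.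
   Context: $\mathcal R\vee\mathcal F_t$ denotes the $\sigma$-algebra generated by $\mathcal R\cup\mathcal F_t$. *)

theory Defs
  imports "HOL-Probability.Probability"
begin

(* Join of two sigma-algebras on the common space of R and G; only the space and the measurable sets
   of the result matter. *)
definition sigma_join :: "'a measure \<Rightarrow> 'a measure \<Rightarrow> 'a measure" where
  "sigma_join R G = sigma (space R) (sets R \<union> sets G)"

end

theory Submission
  imports Defs "HOL-Library.Discrete_Functions"
begin

text \<open>
  The differences \<open>D\<^sub>t = X\<^sub>t - m\<^sub>t\<close> are bounded by 1 almost surely. They are pairwise orthogonal:
  for \<open>s < t\<close>, \<open>D\<^sub>s\<close> is measurable with respect to \<open>\<H>\<^sub>t\<^sub>-\<^sub>1\<close>, and conditioning on \<open>\<H>\<^sub>t\<^sub>-\<^sub>1\<close> gives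
  \<open>E[D\<^sub>s X\<^sub>t] = E[D\<^sub>s m\<^sub>t]\<close>. So the claim is the strong law of large numbers for uniformly bounded
  orthogonal random variables, lemma \<open>AE_averages_tendsto_0_orthogonal\<close>.

  For that law, let \<open>S\<^sub>n\<close> be the partial sums and \<open>B\<close> the bound. Orthogonality gives
  \<open>E[S\<^sub>n\<^sup>2] \<le> n B\<^sup>2\<close>, hence \<open>E[(S\<^sub>n / n)\<^sup>2] \<le> B\<^sup>2 / n\<close>. This is summable along the squares
  \<open>n = k\<^sup>2\<close>, so \<open>S\<^sub>n / n\<close> tends to 0 almost surely along the squares. Between two consecutive squares
  \<open>k\<^sup>2 \<le> n < (k + 1)\<^sup>2\<close> the sum moves by at most \<open>2 k B\<close>, which is negligible compared with \<open>n\<close>.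
\<close>

section \<open>A law of large numbers for bounded orthogonal variables\<close>

lemma averages_tendsto_0_if_along_squares:
  fixes d :: "nat \<Rightarrow> real"
  assumes bound: "\<And>t. t \<ge> 1 \<Longrightarrow> \<bar>d t\<bar> \<le> B"
    and squares: "(\<lambda>k. (\<Sum>t=1..k^2. d t) / real (k^2)) \<longlonglongrightarrow> 0"
  shows "(\<lambda>n. (\<Sum>t=1..n. d t) / real n) \<longlonglongrightarrow> 0"
proof -
  have B: "B \<ge> 0" using bound[of 1] by linarith
  have root: "filterlim floor_sqrt at_top sequentially"
    unfolding filterlim_at_top
  proof
    fix Z :: nat
    show "eventually (\<lambda>n. Z \<le> floor_sqrt n) sequentially"
      using eventually_ge_at_top[of "Z^2"] by eventually_elim (rule le_floor_sqrtI)
  qed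
  have "(\<lambda>k. \<bar>(\<Sum>t=1..k^2. d t) / real (k^2)\<bar> + 2 * B / real k) \<longlonglongrightarrow> 0 + 0"
    using squares by (intro tendsto_add tendsto_rabs_zero lim_const_over_n)
  then have lim: "(\<lambda>n. \<bar>(\<Sum>t=1..(floor_sqrt n)^2. d t) / real ((floor_sqrt n)^2)\<bar>
                       + 2 * B / real (floor_sqrt n)) \<longlonglongrightarrow> 0"
    using filterlim_compose[OF _ root] by simp
  have "eventually (\<lambda>n. norm ((\<Sum>t=1..n. d t) / real n)
      \<le> \<bar>(\<Sum>t=1..(floor_sqrt n)^2. d t) / real ((floor_sqrt n)^2)\<bar> + 2 * B / real (floor_sqrt n))
      sequentially"
    using eventually_gt_at_top[of 0]
  proof eventually_elim
    case (elim n)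
    define k where "k = floor_sqrt n"
    have k: "k > 0" "k^2 \<le> n" using elim by (auto simp: k_def)
    have "n < (Suc k)^2" unfolding k_def by (rule Suc_floor_sqrt_power2_gt)
    then have gap: "n - k^2 \<le> 2 * k" by (simp add: power2_eq_square)
    have "{1..n} = {1..k^2} \<union> {k^2<..n}" using k by auto
    then have split: "(\<Sum>t=1..n. d t) = (\<Sum>t=1..k^2. d t) + (\<Sum>t\<in>{k^2<..n}. d t)"
      by (simp only:) (intro sum.union_disjoint; auto)
    have "\<bar>\<Sum>t\<in>{k^2<..n}. d t\<bar> \<le> (\<Sum>t\<in>{k^2<..n}. \<bar>d t\<bar>)" by (rule sum_abs)
    also have "\<dots> \<le> (\<Sum>t\<in>{k^2<..n}. B)" by (intro sum_mono bound) auto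
    also have "\<dots> = real (n - k^2) * B" by simp
    also have "\<dots> \<le> real (2 * k) * B" using gap B by (intro mult_right_mono) linarith+
    finally have rest: "\<bar>\<Sum>t\<in>{k^2<..n}. d t\<bar> \<le> 2 * real k * B" by simp
    have "norm ((\<Sum>t=1..n. d t) / real n) = \<bar>\<Sum>t=1..n. d t\<bar> / real n" by simp
    also have "\<dots> \<le> (\<bar>\<Sum>t=1..k^2. d t\<bar> + 2 * real k * B) / real n"
      unfolding split using rest by (intro divide_right_mono) linarith+
    also have "\<dots> \<le> (\<bar>\<Sum>t=1..k^2. d t\<bar> + 2 * real k * B) / real (k^2)"
    proof (rule divide_left_mono)
      show "real (k^2) \<le> real n" using k(2) by (rule of_nat_mono)
    qed (use B k elim in auto)
    also have "\<dots> = \<bar>(\<Sum>t=1..k^2. d t) / real (k^2)\<bar> + 2 * B / real k"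
      using k(1) by (simp add: add_divide_distrib power2_eq_square)
    finally show ?case by (simp only: k_def)
  qed
  then show ?thesis by (rule Lim_null_comparison[OF _ lim])
qed

text \<open>
  Summable second moments give \<open>E[\<Sum>\<^sub>k Y\<^sub>k\<^sup>2] < \<infinity>\<close> by monotone convergence, so \<open>\<Sum>\<^sub>k Y\<^sub>k\<^sup>2\<close> converges
  almost surely and its terms tend to 0.
\<close>

lemma AE_tendsto_0_if_summable_second_moments:
  fixes Y :: "nat \<Rightarrow> 'a \<Rightarrow> real"
  assumes int: "\<And>k. integrable M (\<lambda>x. (Y k x)^2)"
    and meas [measurable]: "\<And>k. Y k \<in> borel_measurable M"
    and sum: "summable (\<lambda>k. \<integral>x. (Y k x)^2 \<partial>M)"
  shows "AE x in M. (\<lambda>k. Y k x) \<longlonglongrightarrow> 0"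
proof -
  have "(\<integral>\<^sup>+x. (\<Sum>k. ennreal ((Y k x)^2)) \<partial>M) = (\<Sum>k. \<integral>\<^sup>+x. ennreal ((Y k x)^2) \<partial>M)"
    by (rule nn_integral_suminf) measurable
  also have "\<dots> = (\<Sum>k. ennreal (\<integral>x. (Y k x)^2 \<partial>M))"
    using int by (simp add: nn_integral_eq_integral)
  also have "\<dots> = ennreal (\<Sum>k. \<integral>x. (Y k x)^2 \<partial>M)"
    using sum by (intro suminf_ennreal2) auto
  finally have "(\<integral>\<^sup>+x. (\<Sum>k. ennreal ((Y k x)^2)) \<partial>M) \<noteq> \<infinity>" by simp
  then have "AE x in M. (\<Sum>k. ennreal ((Y k x)^2)) \<noteq> \<infinity>"
    by (intro nn_integral_PInf_AE) measurable
  then show ?thesis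
  proof eventually_elim
    case (elim x)
    then have "summable (\<lambda>k. (Y k x)^2)" by (intro summable_suminf_not_top) auto
    then have "(\<lambda>k. sqrt ((Y k x)^2)) \<longlonglongrightarrow> sqrt 0"
      by (intro tendsto_real_sqrt summable_LIMSEQ_zero)
    then show ?case by (simp add: tendsto_rabs_zero_iff)
  qed
qed

lemma (in prob_space) second_moment_sum_orthogonal_le:
  fixes D :: "nat \<Rightarrow> 'a \<Rightarrow> real"
  assumes meas [measurable]: "\<And>t. t \<ge> 1 \<Longrightarrow> D t \<in> borel_measurable M"
    and bound: "\<And>t. t \<ge> 1 \<Longrightarrow> AE x in M. \<bar>D t x\<bar> \<le> B"
    and orth: "\<And>s t. 1 \<le> s \<Longrightarrow> s < t \<Longrightarrow> (\<integral>x. D s x * D t x \<partial>M) = 0"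
  shows "integrable M (\<lambda>x. (\<Sum>t=1..n. D t x)^2)"
    and "(\<integral>x. (\<Sum>t=1..n. D t x)^2 \<partial>M) \<le> real n * B^2"
proof -
  have prod_bound: "AE x in M. \<bar>D s x * D t x\<bar> \<le> B^2" if "s \<ge> 1" "t \<ge> 1" for s t
    using bound[OF that(1)] bound[OF that(2)]
    by eventually_elim (auto simp: abs_mult power2_eq_square intro: mult_mono)
  have int: "integrable M (\<lambda>x. D s x * D t x)" if "s \<in> {1..n}" "t \<in> {1..n}" for s t
    using prod_bound[of s t] that
    by (intro integrable_const_bound[where B="B^2"]) (auto intro!: borel_measurable_times meas)
  have square: "(\<Sum>t=1..n. D t x)^2 = (\<Sum>s=1..n. \<Sum>t=1..n. D s x * D t x)" for x
    by (simp add: power2_eq_square sum_product)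
  show "integrable M (\<lambda>x. (\<Sum>t=1..n. D t x)^2)"
    unfolding square by (intro Bochner_Integration.integrable_sum int)
  have "(\<integral>x. (\<Sum>t=1..n. D t x)^2 \<partial>M) = (\<Sum>s=1..n. \<Sum>t=1..n. \<integral>x. D s x * D t x \<partial>M)"
    unfolding square using int
    by (subst Bochner_Integration.integral_sum)
       (auto intro!: sum.cong Bochner_Integration.integral_sum Bochner_Integration.integrable_sum)
  also have "\<dots> = (\<Sum>s=1..n. \<Sum>t=1..n. if s = t then \<integral>x. D s x * D s x \<partial>M else 0)"
  proof (intro sum.cong refl)
    fix s t assume "s \<in> {1..n}" "t \<in> {1..n}"
    then show "(\<integral>x. D s x * D t x \<partial>M) = (if s = t then \<integral>x. D s x * D s x \<partial>M else 0)"
      using orth[of s t] orth[of t s] by (cases s t rule: linorder_cases) (auto simp: mult.commute)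
  qed
  also have "\<dots> = (\<Sum>s=1..n. \<integral>x. D s x * D s x \<partial>M)" by simp
  also have "\<dots> \<le> (\<Sum>s=1..n. B^2)"
  proof (rule sum_mono)
    fix s assume s: "s \<in> {1..n}"
    then show "(\<integral>x. D s x * D s x \<partial>M) \<le> B^2"
      using prod_bound[of s s] by (intro integral_le_const int) auto
  qed
  finally show "(\<integral>x. (\<Sum>t=1..n. D t x)^2 \<partial>M) \<le> real n * B^2" by simp
qed

lemma (in prob_space) AE_averages_tendsto_0_orthogonal:
  fixes D :: "nat \<Rightarrow> 'a \<Rightarrow> real"
  assumes meas: "\<And>t. t \<ge> 1 \<Longrightarrow> D t \<in> borel_measurable M"
    and bound: "\<And>t. t \<ge> 1 \<Longrightarrow> AE x in M. \<bar>D t x\<bar> \<le> B"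
    and orth: "\<And>s t. 1 \<le> s \<Longrightarrow> s < t \<Longrightarrow> (\<integral>x. D s x * D t x \<partial>M) = 0"
  shows "AE x in M. (\<lambda>n. (\<Sum>t=1..n. D t x) / real n) \<longlonglongrightarrow> 0"
proof -
  note moment = second_moment_sum_orthogonal_le[OF meas bound orth]
  define Y where "Y k x = (\<Sum>t=1..k^2. D t x) / real (k^2)" for k :: nat and x
  have Y_square: "(Y k x)^2 = (\<Sum>t=1..k^2. D t x)^2 / real (k^2)^2" for k x
    by (simp add: Y_def power_divide)
  have "AE x in M. (\<lambda>k. Y k x) \<longlonglongrightarrow> 0"
  proof (rule AE_tendsto_0_if_summable_second_moments)
    show "integrable M (\<lambda>x. (Y k x)^2)" for k
      unfolding Y_square by (intro Bochner_Integration.integrable_divide_zero moment(1))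
    show "Y k \<in> borel_measurable M" for k
      unfolding Y_def
      by (intro borel_measurable_divide borel_measurable_sum borel_measurable_const meas) auto
    show "summable (\<lambda>k. \<integral>x. (Y k x)^2 \<partial>M)"
    proof (rule summable_comparison_test')
      show "summable (\<lambda>k. B^2 * inverse (real k ^ 2))"
        by (intro summable_mult inverse_power_summable) simp
      show "norm (\<integral>x. (Y k x)^2 \<partial>M) \<le> B^2 * inverse (real k ^ 2)" if "k \<ge> 0" for k
      proof -
        have "norm (\<integral>x. (Y k x)^2 \<partial>M) = (\<integral>x. (\<Sum>t=1..k^2. D t x)^2 \<partial>M) / real (k^2)^2"
          by (simp add: Y_square)
        also have "\<dots> \<le> real (k^2) * B^2 / real (k^2)^2"
          by (intro divide_right_mono moment(2) zero_le_power2)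
        \<comment> \<open>At \<open>k = 0\<close> both sides are 0, since division by 0 yields 0.\<close>
        also have "\<dots> = B^2 * inverse (real k ^ 2)"
          by (cases "k = 0") (simp_all add: field_simps power2_eq_square)
        finally show ?thesis .
      qed
    qed
  qed
  moreover have "AE x in M. \<forall>t\<in>{1..}. \<bar>D t x\<bar> \<le> B"
    using bound by (subst AE_ball_countable) auto
  ultimately show ?thesis
  proof eventually_elim
    case (elim x)
    show ?case
      by (rule averages_tendsto_0_if_along_squares[where B=B]) (use elim in \<open>auto simp: Y_def\<close>)
  qed
qed

section \<open>Joins of sigma-algebras\<close>

lemma space_sigma_join [simp]: "space (sigma_join R G) = space R"
  by (simp add: sigma_join_def space_measure_of_conv)

lemma sets_sigma_join:
  assumes "space G = space R"
  shows "sets (sigma_join R G) = sigma_sets (space R) (sets R \<union> sets G)"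
  unfolding sigma_join_def using sets.space_closed[of R] sets.space_closed[of G] assms
  by (intro sets_measure_of) auto

lemma subalgebra_sigma_join_right:
  assumes "space G = space R"
  shows "subalgebra (sigma_join R G) G"
  using assms by (auto simp: subalgebra_def sets_sigma_join)

lemma subalgebra_sigma_join_mono:
  assumes "space G = space R" "subalgebra G' G"
  shows "subalgebra (sigma_join R G') (sigma_join R G)"
  using assms by (auto simp: subalgebra_def sets_sigma_join intro!: sigma_sets_mono' elim: subsetD)

lemma subalgebra_sigma_join_least:
  assumes "subalgebra M R" "subalgebra M G"
  shows "subalgebra M (sigma_join R G)"
proof -
  have "sigma_sets (space M) (sets R \<union> sets G) \<subseteq> sets M"
    using assms by (intro sets.sigma_sets_subset) (auto simp: subalgebra_def)
  then show ?thesis using assms by (simp add: subalgebra_def sets_sigma_join)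
qed

section \<open>Conditional expectation residuals and the empirical mean\<close>

text \<open>
  The residual \<open>X - E[X | F]\<close> is orthogonal to every \<open>F\<close>-measurable \<open>Z\<close> with \<open>Z X\<close> integrable;
  this makes the differences \<open>D\<^sub>t\<close> pairwise orthogonal.
\<close>

lemma (in sigma_finite_subalgebra) integral_mult_real_cond_exp_residual_eq_0:
  assumes Z: "Z \<in> borel_measurable F" and X: "X \<in> borel_measurable M"
    and int: "integrable M (\<lambda>x. Z x * X x)"
  shows "(\<integral>x. Z x * (X x - real_cond_exp M F X x) \<partial>M) = 0"
  using real_cond_exp_intg[OF int Z X] int by (simp add: right_diff_distrib)

theorem proposition5:
  fixes M :: "'a measure"
    and F :: "nat \<Rightarrow> 'a measure"
    and R :: "'a measure"
    and X :: "nat \<Rightarrow> 'a \<Rightarrow> real"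
    and \<theta> :: "'a \<Rightarrow> real"
  defines "H \<equiv> (\<lambda>t. sigma_join R (F t))"
  defines "m \<equiv> (\<lambda>t. real_cond_exp M (H (t - 1)) (X t))"
  assumes "prob_space M"
    and "filtration (space M) F"
    and "\<And>t. subalgebra M (F t)"
    and "subalgebra M R"
    and "\<And>t. t \<ge> 1 \<Longrightarrow> X t \<in> borel_measurable (F t)"
    and "\<And>t. t \<ge> 1 \<Longrightarrow> AE \<omega> in M. 0 \<le> X t \<omega> \<and> X t \<omega> \<le> 1"
    and "\<theta> \<in> borel_measurable M"
    and "AE \<omega> in M. (\<lambda>n. (1 / real n) * (\<Sum>t=1..n. m t \<omega>)) \<longlonglongrightarrow> \<theta> \<omega>"
  shows "(AE \<omega> in M. (\<lambda>n. (1 / real n) * (\<Sum>t=1..n. X t \<omega>)) \<longlonglongrightarrow> \<theta> \<omega>) \<and>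
         (AE \<omega> in M. (\<lambda>n. (1 / real n) * (\<Sum>t=1..n. X t \<omega>)
                          - (1 / real n) * (\<Sum>t=1..n. m t \<omega>)) \<longlonglongrightarrow> 0)"
proof -
  interpret prob_space M by fact
  have space_F: "space (F t) = space M" for t
    using \<open>\<And>t. subalgebra M (F t)\<close> by (simp add: subalgebra_def)
  have space_R: "space R = space M"
    using \<open>subalgebra M R\<close> by (simp add: subalgebra_def)
  have sub_H: "subalgebra M (H t)" for t
    unfolding H_def by (intro subalgebra_sigma_join_least) fact+
  have H_mono: "subalgebra (H t) (H s)" if "s \<le> t" for s t
    unfolding H_def using that filtration.sets_F_mono[OF \<open>filtration (space M) F\<close> that]
    by (intro subalgebra_sigma_join_mono) (auto simp: subalgebra_def space_F space_R)
  have cond: "sigma_finite_subalgebra M (H t)" for t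
    by (intro finite_measure_subalgebra_is_sigma_finite finite_measure_subalgebra.intro
        finite_measure_subalgebra_axioms.intro sub_H) unfold_locales

  have X_H: "X t \<in> borel_measurable (H t)" if "t \<ge> 1" for t
    unfolding H_def using assms(7)[OF that]
    by (intro measurable_from_subalg[OF subalgebra_sigma_join_right]) (auto simp: space_F space_R)
  have X_M: "X t \<in> borel_measurable M" if "t \<ge> 1" for t
    using X_H[OF that] by (rule measurable_from_subalg[OF sub_H])
  have X_int: "integrable M (X t)" if "t \<ge> 1" for t
    using assms(8)[OF that] X_M[OF that]
    by (intro integrable_const_bound[where B=1]) (auto elim: eventually_mono)
  have m_bounds: "AE \<omega> in M. 0 \<le> m t \<omega> \<and> m t \<omega> \<le> 1" if "t \<ge> 1" for t
  proof -
    have "AE \<omega> in M. X t \<omega> \<ge> 0" "AE \<omega> in M. X t \<omega> \<le> 1"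
      using assms(8)[OF that] by (auto elim: eventually_mono)
    then have "AE \<omega> in M. m t \<omega> \<ge> 0" "AE \<omega> in M. m t \<omega> \<le> 1"
      unfolding m_def using X_int[OF that]
      by (blast intro: sigma_finite_subalgebra.real_cond_exp_ge_c[OF cond]
          sigma_finite_subalgebra.real_cond_exp_le_c[OF cond])+
    then show ?thesis by eventually_elim simp
  qed

  define D where "D t \<omega> = X t \<omega> - m t \<omega>" for t \<omega>
  have D_H: "D s \<in> borel_measurable (H t)" if "1 \<le> s" "s \<le> t" for s t
  proof -
    have "m s \<in> borel_measurable (H (s - 1))" unfolding m_def by simp
    then have "m s \<in> borel_measurable (H t)"
      by (rule measurable_from_subalg[OF H_mono, rotated]) (use that in simp)
    moreover have "X s \<in> borel_measurable (H t)"
      by (rule measurable_from_subalg[OF H_mono X_H]) (use that in simp_all)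
    ultimately show ?thesis unfolding D_def by simp
  qed
  have D_M: "D t \<in> borel_measurable M" if "t \<ge> 1" for t
    by (rule measurable_from_subalg[OF sub_H D_H[OF that order_refl]])
  have D_bound: "AE \<omega> in M. \<bar>D t \<omega>\<bar> \<le> 1" if "t \<ge> 1" for t
    using assms(8)[OF that] m_bounds[OF that] by eventually_elim (auto simp: D_def)
  have D_orth: "(\<integral>\<omega>. D s \<omega> * D t \<omega> \<partial>M) = 0" if "1 \<le> s" "s < t" for s t
  proof -
    have t: "t \<ge> 1" using that by simp
    have "AE \<omega> in M. norm (D s \<omega> * X t \<omega>) \<le> 1"
      using D_bound[OF that(1)] assms(8)[OF t]
      by eventually_elim (auto simp: abs_mult intro: mult_le_one)
    then have "integrable M (\<lambda>\<omega>. D s \<omega> * X t \<omega>)"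
      using D_M[OF that(1)] X_M[OF t] by (intro integrable_const_bound) auto
    then show ?thesis
      unfolding D_def[of t] m_def using that X_M[OF t]
      by (intro sigma_finite_subalgebra.integral_mult_real_cond_exp_residual_eq_0[OF cond] D_H) auto
  qed

  have "AE \<omega> in M. (\<lambda>n. (\<Sum>t=1..n. D t \<omega>) / real n) \<longlonglongrightarrow> 0"
    using D_M D_bound D_orth by (rule AE_averages_tendsto_0_orthogonal)
  then have diff: "AE \<omega> in M. (\<lambda>n. (1 / real n) * (\<Sum>t=1..n. X t \<omega>)
                          - (1 / real n) * (\<Sum>t=1..n. m t \<omega>)) \<longlonglongrightarrow> 0"
    by (simp add: D_def sum_subtractf diff_divide_distrib)
  moreover have "AE \<omega> in M. (\<lambda>n. (1 / real n) * (\<Sum>t=1..n. X t \<omega>)) \<longlonglongrightarrow> \<theta> \<omega>"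
    using diff assms(10)
  proof eventually_elim
    case (elim \<omega>)
    then show ?case using tendsto_add[OF elim] by simp
  qed
  ultimately show ?thesis by blast
qed

end
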